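(* Let $G=(V,w,m)$ be a graph with a fixed vertex $x_0\in V$. If the sphere curvatures with respect to $x_0$ satisfy $\liminf_{R\to\infty}\sum_{r=1}^R\kappa(r)=\infty$, then $m(V)$ is finite. If, additionally, $\inf_{x\in V}m(x)>0$, then $G$ is finite (i.e. $V$ is finite).
   Context: A graph is a triple $G=(V,w,m)$ with $V$ a countable set, $w:V\times V\to[0,\infty)$ symmetric and zero on the diagonal, and $m:V\to(0,\infty)$; $m(V)=\sum_{x\in V}m(x)$. Write $x\sim y$ if $w(x,y)>0$. All graphs are locally finite (for each $x$ only finitely many $y$ satisfy $x\sim y$) and connected; $d(x,y)=\inf\{n: x=x_0\sim\cdots\sim x_n=y\}$ is the combinatorial distance, which is finite by connectedness. $\mathrm{Deg}(x)=\frac1{m(x)}\sum_{y}w(x,y)$. $Lip(1)$ is the set of $f:V\to\mathbb R$ with $|f(x)-f(y)|\le d(x,y)$ for all $x,y$. Curvature: for $x\in V$ and $\varepsilon>0$ let $m_x^\varepsilon(x)=1-\varepsilon\,\mathrm{Deg}(x)$ and $m_x^\varepsilon(y)=\varepsilon w(x,y)/m(x)$ for $y\neq x$; this is a finitely supported probability measure for $\varepsilon$ small. For probability measures $\mu,\nu$ on $V$, $W(\mu,\nu)=\sup_{f}\sum_{x}f(x)(\mu(x)-\nu(x))$, the supremum over bounded $f\in Lip(1)$. For $x\neq y$ let $\kappa_\varepsilon(x,y)=1-\frac{W(m_x^\varepsilon,m_y^\varepsilon)}{d(x,y)}$ and $\kappa(x,y)=\lim_{\varepsilon\to0^+}\frac1\varepsilon\kappa_\varepsilon(x,y)$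 (this limit exists). Sphere curvatures with respect to $x_0$: with $S_r=\{y: d(x_0,y)=r\}$, for $r\ge1$, $\kappa(r)=\min_{y\in S_r}\max_{x\in S_{r-1},\,x\sim y}\kappa(x,y)$ (with value $+\infty$ if $S_r=\emptyset$). *)

theory Defs
  imports "HOL-Analysis.Analysis"
begin

text \<open>
  The vertex set \<open>V\<close> is a carrier set; only the values of \<open>w\<close> and \<open>m\<close> on \<open>V\<close> matter.
\<close>

locale weighted_graph =
  fixes V :: "'a set" and w :: "'a \<Rightarrow> 'a \<Rightarrow> real" and m :: "'a \<Rightarrow> real"
  assumes countable_V: "countable V"
    and w_nonneg: "\<lbrakk>x \<in> V; y \<in> V\<rbrakk> \<Longrightarrow> 0 \<le> w x y"
    and w_sym: "\<lbrakk>x \<in> V; y \<in> V\<rbrakk> \<Longrightarrow> w x y = w y x"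
    and w_diag: "x \<in> V \<Longrightarrow> w x x = 0"
    and m_pos: "x \<in> V \<Longrightarrow> 0 < m x"
begin

definition adj :: "'a \<Rightarrow> 'a \<Rightarrow> bool" where
  "adj x y \<longleftrightarrow> x \<in> V \<and> y \<in> V \<and> 0 < w x y"

definition total_mass :: ennreal where
  "total_mass = (\<Sum>\<^sub>\<infinity>x\<in>V. ennreal (m x))"

text \<open>
  \<open>(adj ^^ n) x y\<close> says that there is a walk with \<open>n\<close> steps from \<open>x\<close> to \<open>y\<close>.
  The infimum is taken in \<open>nat\<close>, so it is meaningful only for vertices joined by a walk.
\<close>

definition gdist :: "'a \<Rightarrow> 'a \<Rightarrow> nat" where
  "gdist x y = Inf {n. (adj ^^ n) x y}"

definition Deg :: "'a \<Rightarrow> real" where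
  "Deg x = 1 / m x * (\<Sum>\<^sub>\<infinity>y\<in>V. w x y)"

definition Lip1 :: "('a \<Rightarrow> real) set" where
  "Lip1 = {f. \<forall>x\<in>V. \<forall>y\<in>V. \<bar>f x - f y\<bar> \<le> real (gdist x y)}"

definition walk_measure :: "real \<Rightarrow> 'a \<Rightarrow> 'a \<Rightarrow> real" where
  "walk_measure \<epsilon> x y = (if y = x then 1 - \<epsilon> * Deg x else \<epsilon> * w x y / m x)"

text \<open>
  Measures on \<open>V\<close> are given by their point masses. The supremum is taken in \<open>real\<close>; in a
  connected graph it is finite for finitely supported measures of equal total mass, in
  particular for the measures \<open>walk_measure \<epsilon> x\<close> of a locally finite connected graph.
\<close>

definition W :: "('a \<Rightarrow> real) \<Rightarrow> ('a \<Rightarrow> real) \<Rightarrow> real" where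
  "W \<mu> \<nu> = (SUP f\<in>{f \<in> Lip1. bounded (f ` V)}. \<Sum>\<^sub>\<infinity>x\<in>V. f x * (\<mu> x - \<nu> x))"

definition curv_eps :: "real \<Rightarrow> 'a \<Rightarrow> 'a \<Rightarrow> real" where
  "curv_eps \<epsilon> x y = 1 - W (walk_measure \<epsilon> x) (walk_measure \<epsilon> y) / real (gdist x y)"

definition curv :: "'a \<Rightarrow> 'a \<Rightarrow> real" where
  "curv x y = Lim (at_right 0) (\<lambda>\<epsilon>. 1 / \<epsilon> * curv_eps \<epsilon> x y)"

definition gsphere :: "'a \<Rightarrow> nat \<Rightarrow> 'a set" where
  "gsphere x0 r = {y \<in> V. gdist x0 y = r}"

text \<open>
  Intended for \<open>r \<ge> 1\<close>. In a locally finite connected graph the sets under \<open>Min\<close> and \<open>Max\<close>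
  are then finite and nonempty.
\<close>

definition sphere_curv :: "'a \<Rightarrow> nat \<Rightarrow> ereal" where
  "sphere_curv x0 r =
    (if gsphere x0 r = {} then \<infinity>
     else ereal (Min ((\<lambda>y. Max ((\<lambda>x. curv x y) ` {x \<in> gsphere x0 (r - 1). adj x y}))
                        ` gsphere x0 r)))"

end

locale locally_finite_connected_graph = weighted_graph +
  assumes locally_finite: "x \<in> V \<Longrightarrow> finite {y. adj x y}"
    and connected: "\<lbrakk>x \<in> V; y \<in> V\<rbrakk> \<Longrightarrow> adj\<^sup>*\<^sup>* x y"

end

theory Submission
  imports Defs
begin

text \<open>
  Testing the Wasserstein distance against \<open>f = d(x0, \<cdot>)\<close> gives
  \<open>\<kappa>(x, y) \<le> \<Delta>f(x) - \<Delta>f(y)\<close> whenever \<open>x \<sim> y\<close> and \<open>f(y) = f(x) + 1\<close>. Following a chain of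
  such edges back to \<open>x0\<close> yields the Laplacian comparison
  \<open>\<Delta>f(y) \<le> Deg(x0) - \<kappa>(1) - \<dots> - \<kappa>(r)\<close> on \<open>S\<^sub>r\<close>, so \<open>\<Delta>f \<le> -1\<close> on all far away spheres.
  Since the integral of \<open>\<Delta>f\<close> over \<open>S\<^sub>r\<close> is the edge weight leaving \<open>S\<^sub>r\<close> outwards minus the one
  entering it from \<open>S\<^bsub>r-1\<^esub>\<close>, the masses of far away spheres are dominated by a telescoping series.
\<close>

context locally_finite_connected_graph
begin

section \<open>Laplacian and combinatorial distance\<close>

definition lap :: "('a \<Rightarrow> real) \<Rightarrow> 'a \<Rightarrow> real" where
  "lap f x = 1 / m x * (\<Sum>y | adj x y. w x y * (f y - f x))"

lemma adj_sym: "adj x y \<longleftrightarrow> adj y x"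
  using w_sym unfolding adj_def by auto

lemma adjD: "adj x y \<Longrightarrow> x \<in> V" "adj x y \<Longrightarrow> y \<in> V" "adj x y \<Longrightarrow> 0 < w x y" "adj x y \<Longrightarrow> x \<noteq> y"
  using w_diag unfolding adj_def by auto

lemma w_eq_0: "\<lbrakk>x \<in> V; y \<in> V; \<not> adj x y\<rbrakk> \<Longrightarrow> w x y = 0"
  using w_nonneg[of x y] unfolding adj_def by auto

lemma adj_pow_sym: "(adj ^^ n) x y \<Longrightarrow> (adj ^^ n) y x"
proof (induction n arbitrary: y)
  case (Suc n)
  then obtain z where "(adj ^^ n) x z" "adj z y" by auto
  with Suc.IH have "(adj ^^ n) z x" "adj y z" using adj_sym by auto
  then show ?case by (meson relpowp_Suc_I2)
qed auto

lemma gdist_le: "(adj ^^ n) x y \<Longrightarrow> gdist x y \<le> n"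
  unfolding gdist_def by (simp add: cInf_lower)

lemma gdist_walk:
  assumes "x \<in> V" "y \<in> V"
  shows "(adj ^^ gdist x y) x y"
proof -
  have "{n. (adj ^^ n) x y} \<noteq> {}"
    using connected[OF assms] rtranclp_power[of adj x y] by auto
  then show ?thesis
    using Inf_nat_def1[of "{n. (adj ^^ n) x y}"] unfolding gdist_def by simp
qed

lemma gdist_refl [simp]: "gdist x x = 0"
  using gdist_le[of 0 x x] by simp

lemma gdist_sym: "\<lbrakk>x \<in> V; y \<in> V\<rbrakk> \<Longrightarrow> gdist x y = gdist y x"
  by (meson adj_pow_sym gdist_le gdist_walk order_antisym)

lemma gdist_triangle:
  assumes "x \<in> V" "y \<in> V" "z \<in> V"
  shows "gdist x z \<le> gdist x y + gdist y z"
  using gdist_walk[of x y] gdist_walk[of y z] assms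
  by (intro gdist_le) (auto simp: relpowp_add)

lemma gdist_pos:
  assumes "x \<in> V" "y \<in> V" "x \<noteq> y"
  shows "0 < gdist x y"
proof (rule ccontr)
  assume "\<not> 0 < gdist x y"
  with gdist_walk[OF assms(1,2)] have "(adj ^^ 0) x y" by simp
  with assms show False by simp
qed

lemma adj_gdist:
  assumes "adj x y"
  shows "gdist x y = 1"
proof -
  have "(adj ^^ 1) x y" using assms by (simp add: relpowp_1 del: relpowp.simps One_nat_def)
  from gdist_le[OF this] gdist_pos[of x y] adjD[OF assms] show ?thesis by simp
qed

lemma gdist_Lip1: "x0 \<in> V \<Longrightarrow> (\<lambda>x. real (gdist x0 x)) \<in> Lip1"
  unfolding Lip1_def
proof safe
  fix x y assume "x0 \<in> V" "x \<in> V" "y \<in> V"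
  then show "\<bar>real (gdist x0 x) - real (gdist x0 y)\<bar> \<le> real (gdist x y)"
    using gdist_triangle[of x0 x y] gdist_triangle[of x0 y x] gdist_sym[of x y] by simp
qed

lemma Lip1_adj: "\<lbrakk>f \<in> Lip1; adj x y\<rbrakk> \<Longrightarrow> \<bar>f x - f y\<bar> \<le> 1"
  using adj_gdist[of x y] adjD[of x y] unfolding Lip1_def by fastforce

section \<open>Wasserstein distance of walk measures through the Laplacian\<close>

lemma Deg_eq:
  assumes "x \<in> V"
  shows "Deg x = 1 / m x * (\<Sum>y | adj x y. w x y)"
proof -
  have "(\<Sum>\<^sub>\<infinity>y\<in>V. w x y) = (\<Sum>\<^sub>\<infinity>y\<in>{y. adj x y}. w x y)"
    using assms w_eq_0 adjD by (intro infsum_cong_neutral) auto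
  then show ?thesis using locally_finite[OF assms] by (simp add: Deg_def)
qed

text \<open>The defect \<open>\<epsilon> * Deg x\<close> at \<open>x\<close> is exactly the mass
  sent to the neighbours, so the mean of \<open>f\<close> is affine in \<open>\<epsilon>\<close>
  with slope \<open>lap f x\<close>. \<open>F\<close> may be larger than the support, so that two
  walk measures can be summed over one common set.\<close>

lemma sum_walk_measure:
  assumes "x \<in> V" "finite F" "F \<subseteq> V" "x \<in> F" "{y. adj x y} \<subseteq> F"
  shows "(\<Sum>z\<in>F. f z * walk_measure \<epsilon> x z) = f x + \<epsilon> * lap f x"
proof -
  have "(\<Sum>z\<in>F. f z * walk_measure \<epsilon> x z)
      = f x * (1 - \<epsilon> * Deg x) + (\<Sum>z\<in>F-{x}. f z * (\<epsilon> * w x z / m x))"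
    using assms(2,4) by (subst sum.remove[of F x]) (auto simp: walk_measure_def)
  also have "(\<Sum>z\<in>F-{x}. f z * (\<epsilon> * w x z / m x)) = (\<Sum>z | adj x z. f z * (\<epsilon> * w x z / m x))"
    using assms w_eq_0[OF assms(1)] adjD(4)[of x x] by (intro sum.mono_neutral_right) auto
  finally show ?thesis
    unfolding Deg_eq[OF assms(1)] lap_def
    by (simp add: algebra_simps sum_subtractf sum_distrib_left sum_distrib_right sum_divide_distrib)
qed

lemma infsum_walk_measure_diff:
  assumes "x \<in> V" "y \<in> V"
  shows "(\<Sum>\<^sub>\<infinity>z\<in>V. f z * (walk_measure \<epsilon> x z - walk_measure \<epsilon> y z))
       = (f x - f y) + \<epsilon> * (lap f x - lap f y)"
proof -
  define F where "F = {x, y} \<union> {z. adj x z} \<union> {z. adj y z}"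
  have F: "finite F" "F \<subseteq> V" "x \<in> F" "y \<in> F" "{z. adj x z} \<subseteq> F" "{z. adj y z} \<subseteq> F"
    using assms locally_finite adjD by (auto simp: F_def)
  have "(\<Sum>\<^sub>\<infinity>z\<in>V. f z * (walk_measure \<epsilon> x z - walk_measure \<epsilon> y z))
      = (\<Sum>\<^sub>\<infinity>z\<in>F. f z * (walk_measure \<epsilon> x z - walk_measure \<epsilon> y z))"
    using assms F w_eq_0 by (intro infsum_cong_neutral) (auto simp: walk_measure_def F_def)
  also have "\<dots> = (\<Sum>z\<in>F. f z * walk_measure \<epsilon> x z) - (\<Sum>z\<in>F. f z * walk_measure \<epsilon> y z)"
    using F(1) by (simp add: sum_subtractf right_diff_distrib)
  also have "\<dots> = (f x + \<epsilon> * lap f x) - (f y + \<epsilon> * lap f y)"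
    using F assms by (simp add: sum_walk_measure)
  finally show ?thesis by (simp add: algebra_simps)
qed

text \<open>A bound uniform in \<open>f\<close>: it makes the supremum defining \<open>W\<close>
  bounded above, without which the real-valued \<open>SUP\<close> could not be compared with its
  members.\<close>

lemma abs_lap_le_Deg:
  assumes "f \<in> Lip1" "x \<in> V"
  shows "\<bar>lap f x\<bar> \<le> Deg x"
proof -
  have "\<bar>\<Sum>y | adj x y. w x y * (f y - f x)\<bar> \<le> (\<Sum>y | adj x y. \<bar>w x y * (f y - f x)\<bar>)"
    by (rule sum_abs)
  also have "\<dots> \<le> (\<Sum>y | adj x y. w x y)"
  proof (rule sum_mono)
    fix y assume "y \<in> {y. adj x y}"
    then show "\<bar>w x y * (f y - f x)\<bar> \<le> w x y"
      using Lip1_adj[OF assms(1), of x y] adjD(3)[of x y]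
      by (simp add: abs_mult abs_minus_commute mult_left_le)
  qed
  finally show ?thesis
    using m_pos[OF assms(2)] unfolding lap_def Deg_eq[OF assms(2)]
    by (simp add: abs_mult divide_right_mono)
qed

lemma W_walk_measure:
  assumes "x \<in> V" "y \<in> V"
  shows "W (walk_measure \<epsilon> x) (walk_measure \<epsilon> y)
       = (SUP f\<in>{f \<in> Lip1. bounded (f ` V)}. (f x - f y) + \<epsilon> * (lap f x - lap f y))"
  unfolding W_def infsum_walk_measure_diff[OF assms] ..

lemma W_walk_measure_upper:
  assumes "x \<in> V" "y \<in> V" "0 < \<epsilon>" "f \<in> Lip1" "bounded (f ` V)"
  shows "(f x - f y) + \<epsilon> * (lap f x - lap f y) \<le> W (walk_measure \<epsilon> x) (walk_measure \<epsilon> y)"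
  unfolding W_walk_measure[OF assms(1,2)]
proof (rule cSUP_upper)
  show "bdd_above ((\<lambda>f. (f x - f y) + \<epsilon> * (lap f x - lap f y)) ` {f \<in> Lip1. bounded (f ` V)})"
  proof (rule bdd_aboveI2)
    fix f assume "f \<in> {f \<in> Lip1. bounded (f ` V)}"
    then have f: "f \<in> Lip1" by simp
    have "lap f x - lap f y \<le> Deg x + Deg y"
      using abs_lap_le_Deg[OF f assms(1)] abs_lap_le_Deg[OF f assms(2)] by linarith
    then have "\<epsilon> * (lap f x - lap f y) \<le> \<epsilon> * (Deg x + Deg y)"
      using assms(3) by (intro mult_left_mono) auto
    moreover have "f x - f y \<le> gdist x y"
      using f assms(1,2) unfolding Lip1_def by (auto simp: abs_le_iff)
    ultimately show "(f x - f y) + \<epsilon> * (lap f x - lap f y) \<le> gdist x y + \<epsilon> * (Deg x + Deg y)"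
      by linarith
  qed
qed (use assms in auto)

section \<open>Curvature bounded by Laplacian differences\<close>

text \<open>A test function that drops by the full distance from \<open>x\<close> to
  \<open>y\<close> cancels the 1 in \<open>curv_eps\<close>. What remains is linear in
  \<open>\<epsilon>\<close>, so the bound after division is independent of
  \<open>\<epsilon>\<close>.\<close>

lemma curv_eps_le:
  assumes "x \<in> V" "y \<in> V" "x \<noteq> y" "0 < \<epsilon>" "f \<in> Lip1" "bounded (f ` V)" "f x - f y = gdist x y"
  shows "1 / \<epsilon> * curv_eps \<epsilon> x y \<le> (lap f y - lap f x) / gdist x y"
proof -
  have d: "0 < gdist x y" by (rule gdist_pos) fact+
  have "gdist x y + \<epsilon> * (lap f x - lap f y) \<le> W (walk_measure \<epsilon> x) (walk_measure \<epsilon> y)"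
    using W_walk_measure_upper[OF assms(1,2,4,5,6)] assms(7) by simp
  then have "(gdist x y + \<epsilon> * (lap f x - lap f y)) / gdist x y
      \<le> W (walk_measure \<epsilon> x) (walk_measure \<epsilon> y) / gdist x y"
    by (rule divide_right_mono) simp
  then have "curv_eps \<epsilon> x y \<le> \<epsilon> * ((lap f y - lap f x) / gdist x y)"
    using d by (simp add: curv_eps_def add_divide_distrib diff_divide_distrib right_diff_distrib)
  then show ?thesis using assms(4) by (simp add: pos_divide_le_eq mult.commute)
qed

text \<open>
  As a supremum of affine functions of \<open>\<epsilon>\<close>, the Wasserstein distance is convex in \<open>\<epsilon>\<close>, and it
  is at most \<open>d(x, y)\<close> at \<open>\<epsilon> = 0\<close>.
\<close>

lemma curv_eps_antimono:
  assumes "x \<in> V" "y \<in> V" "x \<noteq> y" "0 < a" "a \<le> b"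
  shows "1 / b * curv_eps b x y \<le> 1 / a * curv_eps a x y"
proof -
  let ?W = "\<lambda>\<epsilon>. W (walk_measure \<epsilon> x) (walk_measure \<epsilon> y)"
  have b: "0 < b" using assms by simp
  \<comment> \<open>This is convexity on the segment from 0 to \<open>b\<close>, on which
    \<open>a\<close> has weight \<open>a/b\<close> towards \<open>b\<close>; at the end 0 the
    objective is \<open>f x - f y\<close>, hence at most the distance.\<close>
  have "?W a \<le> (1 - a/b) * gdist x y + a/b * ?W b"
    unfolding W_walk_measure[OF assms(1,2), of a]
  proof (rule cSUP_least)
    have "(\<lambda>_. 0) \<in> {f \<in> Lip1. bounded (f ` V)}"
      unfolding Lip1_def by (auto simp: image_constant_conv)
    then show "{f \<in> Lip1. bounded (f ` V)} \<noteq> {}" by blast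
  next
    fix f assume f: "f \<in> {f \<in> Lip1. bounded (f ` V)}"
    have "f x - f y \<le> gdist x y"
      using f assms(1,2) unfolding Lip1_def by (auto simp: abs_le_iff)
    then have "(1 - a/b) * (f x - f y) \<le> (1 - a/b) * gdist x y"
      using assms(5) b by (intro mult_left_mono) auto
    moreover have "a/b * ((f x - f y) + b * (lap f x - lap f y)) \<le> a/b * ?W b"
      using W_walk_measure_upper[OF assms(1,2) b] f assms(4) b by (intro mult_left_mono) auto
    moreover have "(f x - f y) + a * (lap f x - lap f y)
        = (1 - a/b) * (f x - f y) + a/b * ((f x - f y) + b * (lap f x - lap f y))"
      using b by (simp add: field_simps)
    ultimately show "(f x - f y) + a * (lap f x - lap f y) \<le> (1 - a/b) * gdist x y + a/b * ?W b"
      by linarith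
  qed
  then have "?W a / gdist x y \<le> ((1 - a/b) * gdist x y + a/b * ?W b) / gdist x y"
    by (rule divide_right_mono) simp
  then have "a/b * curv_eps b x y \<le> curv_eps a x y"
    using gdist_pos[OF assms(1-3)]
    by (simp add: curv_eps_def add_divide_distrib right_diff_distrib)
  then show ?thesis using assms(4) b by (simp add: field_simps)
qed

text \<open>The bound on each quotient passes to \<open>curv\<close> only once the limit in
  \<open>Lim\<close> is known to exist. It does, since the quotients increase as
  \<open>\<epsilon>\<close> decreases to 0 and are bounded above.\<close>

lemma curv_le_bounded:
  assumes "x \<in> V" "y \<in> V" "x \<noteq> y" "f \<in> Lip1" "bounded (f ` V)" "f x - f y = gdist x y"
  shows "curv x y \<le> (lap f y - lap f x) / gdist x y"
proof -
  let ?h = "\<lambda>\<epsilon>. 1 / \<epsilon> * curv_eps \<epsilon> x y" and ?B = "(lap f y - lap f x) / gdist x y"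
  have le: "?h \<epsilon> \<le> ?B" if "0 < \<epsilon>" for \<epsilon>
    using curv_eps_le[OF assms(1-3) that assms(4-6)] .
  \<comment> \<open>The sign is flipped because \<open>Lim_right_bound\<close> treats nondecreasing
    functions that are bounded below.\<close>
  have "((\<lambda>\<epsilon>. - ?h \<epsilon>) \<longlongrightarrow> Inf ((\<lambda>\<epsilon>. - ?h \<epsilon>) ` ({0<..} \<inter> UNIV))) (at 0 within ({0<..} \<inter> UNIV))"
    using curv_eps_antimono[OF assms(1-3)] le
    by (intro Lim_right_bound[where K = "- ?B"]) auto
  then obtain L where L: "((\<lambda>\<epsilon>. - ?h \<epsilon>) \<longlongrightarrow> L) (at_right 0)" by auto
  then have lim: "(?h \<longlongrightarrow> - L) (at_right 0)"
    using tendsto_minus[OF L] by simp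
  then have "curv x y = - L"
    unfolding curv_def by (intro tendsto_Lim) auto
  moreover have "- L \<le> ?B"
    using lim
  proof (rule tendsto_upperbound)
    show "\<forall>\<^sub>F \<epsilon> in at_right 0. ?h \<epsilon> \<le> ?B"
      using eventually_at_right_less[of 0] by eventually_elim (rule le)
  qed simp
  ultimately show ?thesis by simp
qed

lemma curv_le:
  assumes "x \<in> V" "y \<in> V" "x \<noteq> y" "f \<in> Lip1" "f x - f y = gdist x y"
  shows "curv x y \<le> (lap f y - lap f x) / gdist x y"
proof -
  define F where "F = {x, y} \<union> {z. adj x z} \<union> {z. adj y z}"
  have "finite F" using assms locally_finite by (auto simp: F_def)
  then obtain N where N: "\<And>z. z \<in> F \<Longrightarrow> \<bar>f z\<bar> \<le> N"
    using finite_imp_bounded[of "f ` F"] unfolding bounded_iff by auto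
  \<comment> \<open>Clamping to \<open>[-N, N]\<close> is a contraction, so \<open>g\<close> stays
    in \<open>Lip1\<close>, and by the choice of \<open>N\<close> it agrees with \<open>f\<close> on
    \<open>F\<close>.\<close>
  define g where "g z = max (- N) (min N (f z))" for z
  have "0 \<le> N" using N[of x] by (auto simp: F_def)
  then have g_le: "\<bar>g z\<bar> \<le> N" for z by (auto simp: g_def)
  have g_eq: "g z = f z" if "z \<in> F" for z using N[OF that] by (auto simp: g_def)
  have "\<bar>g a - g b\<bar> \<le> \<bar>f a - f b\<bar>" for a b by (auto simp: g_def)
  with assms(4) have "g \<in> Lip1" unfolding Lip1_def using order_trans by blast
  moreover have "bounded (g ` V)" using g_le unfolding bounded_iff by auto
  moreover have "lap g x = lap f x" "lap g y = lap f y"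
    unfolding lap_def by (simp_all add: g_eq F_def)
  moreover have "g x = f x" "g y = f y" using g_eq by (auto simp: F_def)
  ultimately show ?thesis using curv_le_bounded[of x y g] assms by simp
qed

lemma lap_gdist_diff:
  assumes "x0 \<in> V" "adj x y" "gdist x0 y = Suc (gdist x0 x)"
  shows "lap (\<lambda>z. real (gdist x0 z)) y \<le> lap (\<lambda>z. real (gdist x0 z)) x - curv x y"
proof -
  let ?f = "\<lambda>z. real (gdist x0 z)"
  \<comment> \<open>The test function must decrease from \<open>x\<close> to \<open>y\<close>, while
    the distance from \<open>x0\<close> increases along this edge; hence the minus sign.\<close>
  have "(\<lambda>z. - ?f z) \<in> Lip1"
    using gdist_Lip1[OF assms(1)] unfolding Lip1_def by (simp add: abs_minus_commute)
  then have "curv x y \<le> (lap (\<lambda>z. - ?f z) y - lap (\<lambda>z. - ?f z) x) / gdist x y"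
    using assms adjD[OF assms(2)] adj_gdist[OF assms(2)] by (intro curv_le) auto
  moreover have "lap (\<lambda>z. - ?f z) v = - lap ?f v" for v
    unfolding lap_def by (simp add: algebra_simps sum_subtractf)
  ultimately show ?thesis using adj_gdist[OF assms(2)] by simp
qed

section \<open>Spheres and Laplacian comparison\<close>

lemma gsphere_pred:
  assumes "x0 \<in> V" "y \<in> gsphere x0 (Suc r)"
  shows "\<exists>x\<in>gsphere x0 r. adj x y"
proof -
  have y: "y \<in> V" "gdist x0 y = Suc r" using assms(2) by (auto simp: gsphere_def)
  then obtain x where x: "(adj ^^ r) x0 x" "adj x y"
    using gdist_walk[OF assms(1) y(1)] by auto
  have "gdist x0 x \<le> r" using gdist_le[OF x(1)] .
  moreover have "Suc r \<le> gdist x0 x + 1"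
    using gdist_triangle[of x0 x y] adj_gdist[OF x(2)] adjD[OF x(2)] assms(1) y by simp
  ultimately show ?thesis using x(2) adjD[OF x(2)] by (auto simp: gsphere_def)
qed

lemma gsphere_0: "x0 \<in> V \<Longrightarrow> gsphere x0 0 = {x0}"
  using gdist_pos[of x0] by (force simp: gsphere_def)

lemma finite_gsphere: "x0 \<in> V \<Longrightarrow> finite (gsphere x0 r)"
proof (induction r)
  case (Suc r)
  have "gsphere x0 (Suc r) \<subseteq> (\<Union>x\<in>gsphere x0 r. {y. adj x y})"
    using gsphere_pred[OF Suc.prems] by blast
  moreover have "finite (\<Union>x\<in>gsphere x0 r. {y. adj x y})"
    using Suc locally_finite by (auto simp: gsphere_def)
  ultimately show ?case by (rule finite_subset)
qed (simp add: gsphere_0)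

text \<open>The minimum is at most its entry for the given \<open>y\<close>, and the maximum in that
  entry is attained at some \<open>x\<close>. This \<open>x\<close> is the next vertex on the chain
  back to \<open>x0\<close>.\<close>

lemma sphere_curv_attained:
  assumes "x0 \<in> V" "y \<in> gsphere x0 (Suc r)"
  shows "\<exists>x\<in>gsphere x0 r. adj x y \<and> sphere_curv x0 (Suc r) \<le> ereal (curv x y)"
proof -
  let ?M = "\<lambda>y. (\<lambda>x. curv x y) ` {x \<in> gsphere x0 r. adj x y}"
  have "Min ((\<lambda>y. Max (?M y)) ` gsphere x0 (Suc r)) \<le> Max (?M y)"
    using finite_gsphere[OF assms(1)] assms(2) by (intro Min_le) auto
  moreover have "Max (?M y) \<in> ?M y"
    using finite_gsphere[OF assms(1)] gsphere_pred[OF assms] by (intro Max_in) auto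
  ultimately show ?thesis using assms(2) by (auto simp: sphere_curv_def)
qed

lemma lap_gdist_center:
  assumes "x0 \<in> V"
  shows "lap (\<lambda>z. real (gdist x0 z)) x0 = Deg x0"
  unfolding lap_def Deg_eq[OF assms] using adj_gdist by simp

text \<open>Induction along that chain: each edge lowers the Laplacian of the distance by at least
  the sphere curvature, starting from the value \<open>Deg x0\<close> at the centre.\<close>

lemma laplacian_comparison:
  assumes "x0 \<in> V" "y \<in> gsphere x0 r"
  shows "(\<Sum>j=1..r. sphere_curv x0 j) \<le> ereal (Deg x0 - lap (\<lambda>z. real (gdist x0 z)) y)"
  using assms(2)
proof (induction r arbitrary: y)
  case 0
  then show ?case using assms(1) by (simp add: gsphere_0 lap_gdist_center)
next
  case (Suc r)
  obtain x where x: "x \<in> gsphere x0 r" "adj x y" "sphere_curv x0 (Suc r) \<le> ereal (curv x y)"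
    using sphere_curv_attained[OF assms(1) Suc.prems] by auto
  have "(\<Sum>j=1..Suc r. sphere_curv x0 j)
      \<le> ereal (Deg x0 - lap (\<lambda>z. real (gdist x0 z)) x) + ereal (curv x y)"
    using add_mono[OF Suc.IH[OF x(1)] x(3)] by simp
  also have "\<dots> \<le> ereal (Deg x0 - lap (\<lambda>z. real (gdist x0 z)) y)"
    using lap_gdist_diff[OF assms(1) x(2)] x(1) Suc.prems by (simp add: gsphere_def)
  finally show ?case .
qed

section \<open>Flux between spheres and the total mass\<close>

definition flux :: "'a \<Rightarrow> nat \<Rightarrow> real" where
  "flux x0 r = (\<Sum>y\<in>gsphere x0 r. \<Sum>z\<in>gsphere x0 (Suc r). w y z)"

lemma flux_nonneg: "0 \<le> flux x0 r"
  unfolding flux_def by (intro sum_nonneg w_nonneg) (auto simp: gsphere_def)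

text \<open>Neighbours of \<open>y\<close> lie in its own sphere or an adjacent one, where the
  distance from \<open>x0\<close> differs from that of \<open>y\<close> by 0, 1 or -1.\<close>

lemma lap_gdist_gsphere:
  assumes "x0 \<in> V" "y \<in> gsphere x0 (Suc r)"
  shows "m y * lap (\<lambda>z. real (gdist x0 z)) y
       = (\<Sum>z\<in>gsphere x0 (Suc (Suc r)). w y z) - (\<Sum>z\<in>gsphere x0 r. w y z)"
proof -
  let ?g = "\<lambda>z. w y z * (real (gdist x0 z) - real (gdist x0 y))"
  let ?A = "gsphere x0 r" and ?B = "gsphere x0 (Suc r)" and ?C = "gsphere x0 (Suc (Suc r))"
  have y: "y \<in> V" "gdist x0 y = Suc r" using assms(2) by (auto simp: gsphere_def)
  have fin: "finite ?A" "finite ?B" "finite ?C" using finite_gsphere[OF assms(1)] by auto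
  have disj: "?A \<inter> ?B = {}" "(?A \<union> ?B) \<inter> ?C = {}" by (auto simp: gsphere_def)
  have sub: "z \<in> ?A \<union> ?B \<union> ?C" if "adj y z" for z
  proof -
    have "gdist x0 z \<le> gdist x0 y + 1" "gdist x0 y \<le> gdist x0 z + 1"
      using gdist_triangle[of x0 y z] gdist_triangle[of x0 z y] that adj_gdist[of y z]
        adj_gdist[of z y] adj_sym adjD[OF that] assms(1) by auto
    then have "gdist x0 z = r \<or> gdist x0 z = Suc r \<or> gdist x0 z = Suc (Suc r)"
      using y(2) by linarith
    then show ?thesis using adjD(2)[OF that] by (auto simp: gsphere_def)
  qed
  have "m y * lap (\<lambda>z. real (gdist x0 z)) y = (\<Sum>z | adj y z. ?g z)"
    using m_pos[OF y(1)] by (simp add: lap_def)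
  also have "\<dots> = (\<Sum>z\<in>?A \<union> ?B \<union> ?C. ?g z)"
    using fin sub w_eq_0[OF y(1)] by (intro sum.mono_neutral_left) (auto simp: gsphere_def)
  also have "\<dots> = (\<Sum>z\<in>?A. ?g z) + (\<Sum>z\<in>?B. ?g z) + (\<Sum>z\<in>?C. ?g z)"
    using fin disj by (simp add: sum.union_disjoint)
  also have "(\<Sum>z\<in>?A. ?g z) = - (\<Sum>z\<in>?A. w y z)"
    unfolding sum_negf[symmetric] by (rule sum.cong) (auto simp: gsphere_def y)
  also have "(\<Sum>z\<in>?B. ?g z) = 0"
    by (rule sum.neutral) (auto simp: gsphere_def y)
  also have "(\<Sum>z\<in>?C. ?g z) = (\<Sum>z\<in>?C. w y z)"
    by (rule sum.cong) (auto simp: gsphere_def y)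
  finally show ?thesis by simp
qed

text \<open>A discrete Green formula: by symmetry of \<open>w\<close>, the weight from the sphere
  inwards is the outward flux of the previous sphere.\<close>

lemma sum_lap_gdist_gsphere:
  assumes "x0 \<in> V"
  shows "(\<Sum>y\<in>gsphere x0 (Suc r). m y * lap (\<lambda>z. real (gdist x0 z)) y)
       = flux x0 (Suc r) - flux x0 r"
proof -
  have "(\<Sum>y\<in>gsphere x0 (Suc r). \<Sum>z\<in>gsphere x0 r. w y z) = flux x0 r"
    unfolding flux_def
    by (subst sum.swap, intro sum.cong refl w_sym) (auto simp: gsphere_def)
  then show ?thesis
    using lap_gdist_gsphere[OF assms] by (simp add: sum_subtractf flux_def)
qed

lemma total_mass_finite:
  assumes "x0 \<in> V"
    and "\<And>r y. \<lbrakk>R \<le> r; y \<in> gsphere x0 r\<rbrakk> \<Longrightarrow> lap (\<lambda>z. real (gdist x0 z)) y \<le> - 1"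
  shows "total_mass < \<infinity>"
proof -
  define M where "M r = (\<Sum>y\<in>gsphere x0 r. m y)" for r
  \<comment> \<open>Mass of the ball of radius \<open>R\<close> plus the first term of the series
    that telescopes beyond it.\<close>
  define C where "C = (\<Sum>r\<le>R. M r) + flux x0 R"
  have M_le: "M (Suc r) \<le> flux x0 r - flux x0 (Suc r)" if "R \<le> r" for r
  proof -
    have "(\<Sum>y\<in>gsphere x0 (Suc r). m y * lap (\<lambda>z. real (gdist x0 z)) y)
        \<le> (\<Sum>y\<in>gsphere x0 (Suc r). m y * (- 1))"
      using assms(2)[of "Suc r"] that m_pos
      by (intro sum_mono mult_left_mono) (auto simp: gsphere_def less_imp_le)
    then show ?thesis
      using sum_lap_gdist_gsphere[OF assms(1), of r] by (simp add: M_def sum_negf)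
  qed
  have tel: "(\<Sum>r\<le>R + k. M r) \<le> C - flux x0 (R + k)" for k
  proof (induction k)
    case (Suc k)
    then show ?case using M_le[of "R + k"] by simp
  qed (simp add: C_def)
  have bound: "sum m F \<le> C" if F: "finite F" "F \<subseteq> V" for F
  proof -
    \<comment> \<open>A finite set lies in some ball, even in the one of radius
      \<open>R + k\<close>, to which the telescoped bound applies.\<close>
    obtain k where k: "\<And>x. x \<in> F \<Longrightarrow> gdist x0 x \<le> k"
      using F(1) finite_nat_set_iff_bounded_le[of "gdist x0 ` F"] by auto
    have fin: "finite (\<Union>r\<le>R + k. gsphere x0 r)"
      using finite_gsphere[OF assms(1)] by auto
    have "sum m F \<le> sum m (\<Union>r\<le>R + k. gsphere x0 r)"
      using F k fin m_pos
      by (intro sum_mono2) (force simp: gsphere_def less_imp_le)+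
    also have "\<dots> = (\<Sum>r\<le>R + k. M r)"
      unfolding M_def using finite_gsphere[OF assms(1)]
      by (intro sum.UNION_disjoint) (auto simp: gsphere_def)
    also have "\<dots> \<le> C" using tel[of k] flux_nonneg[of x0 "R + k"] by linarith
    finally show ?thesis .
  qed
  have "total_mass = (SUP F\<in>{F. finite F \<and> F \<subseteq> V}. \<Sum>x\<in>F. ennreal (m x))"
    unfolding total_mass_def by (intro nonneg_infsum_complete) auto
  also have "\<dots> \<le> ennreal C"
  proof (rule SUP_least)
    fix F assume F: "F \<in> {F. finite F \<and> F \<subseteq> V}"
    then have "(\<Sum>x\<in>F. ennreal (m x)) = ennreal (sum m F)"
      using m_pos by (intro sum_ennreal) (auto simp: less_imp_le)
    with F bound show "(\<Sum>x\<in>F. ennreal (m x)) \<le> ennreal C" by (simp add: ennreal_leI)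
  qed
  finally show ?thesis by (simp add: le_less_trans)
qed

lemma finite_if_mass_bounded_below:
  assumes "total_mass < \<infinity>" "(INF x\<in>V. m x) > 0"
  shows "finite V"
proof (rule ccontr)
  assume inf: "infinite V"
  define c where "c = (INF x\<in>V. m x)"
  have c: "c \<le> m x" if "x \<in> V" for x
    unfolding c_def using that m_pos by (intro cINF_lower bdd_belowI2[where m = 0]) (auto simp: less_imp_le)
  obtain C where C: "total_mass = ennreal C" "0 \<le> C"
    using assms(1) by (cases total_mass) auto
  have "0 < c" using assms(2) by (simp add: c_def)
  \<comment> \<open>Any \<open>n\<close> distinct vertices weigh at least \<open>n * c\<close>,
    which already exceeds the total mass.\<close>
  then obtain n :: nat where n: "C < n * c" using reals_Archimedean3 by blast
  obtain F where F: "finite F" "card F = n" "F \<subseteq> V"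
    using infinite_arbitrarily_large[OF inf] by blast
  have "ennreal (n * c) \<le> ennreal (sum m F)"
    using sum_bounded_below[of F c m] F c by (intro ennreal_leI) auto
  also have "\<dots> = (\<Sum>x\<in>F. ennreal (m x))"
    using m_pos F by (intro sum_ennreal[symmetric]) (auto simp: less_imp_le)
  also have "\<dots> = (\<Sum>\<^sub>\<infinity>x\<in>F. ennreal (m x))" using F by simp
  also have "\<dots> \<le> total_mass"
    unfolding total_mass_def using F
    by (intro infsum_mono_neutral nonneg_summable_on_complete) auto
  finally show False using C n by (simp add: ennreal_le_iff)
qed

end

theorem corollary4p20:
  fixes V :: "'a set" and w :: "'a \<Rightarrow> 'a \<Rightarrow> real" and m :: "'a \<Rightarrow> real" and x0 :: 'a
  assumes "locally_finite_connected_graph V w m"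
    and "x0 \<in> V"
    and "liminf (\<lambda>R. \<Sum>r=1..R. weighted_graph.sphere_curv V w m x0 r) = \<infinity>"
  shows "weighted_graph.total_mass V m < \<infinity> \<and> ((INF x\<in>V. m x) > 0 \<longrightarrow> finite V)"
proof -
  interpret locally_finite_connected_graph V w m by fact
  \<comment> \<open>The threshold makes the comparison bound \<open>Deg x0\<close> minus the
    curvature sum drop below -1. For empty spheres the resulting claim is vacuous.\<close>
  have "ereal (Deg x0 + 1) < liminf (\<lambda>R. \<Sum>r=1..R. sphere_curv x0 r)"
    using assms(3) by simp
  then have "\<forall>\<^sub>F R in sequentially. ereal (Deg x0 + 1) < (\<Sum>r=1..R. sphere_curv x0 r)"
    by (rule less_LiminfD)
  then obtain R where R: "\<And>r. R \<le> r \<Longrightarrow> ereal (Deg x0 + 1) < (\<Sum>j=1..r. sphere_curv x0 j)"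
    unfolding eventually_sequentially by blast
  have "lap (\<lambda>z. real (gdist x0 z)) y \<le> - 1" if "R \<le> r" "y \<in> gsphere x0 r" for r y
    using less_le_trans[OF R[OF that(1)] laplacian_comparison[OF assms(2) that(2)]] by simp
  then have "total_mass < \<infinity>" by (rule total_mass_finite[OF assms(2)])
  then show ?thesis using finite_if_mass_bounded_below by blast
qed

end
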